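(* Let $t,\ell,k,d$ be positive integers. Let $G$ be a subgraph of $H\boxtimes P\boxtimes K_\ell$, for some graph $H$ of treewidth at most $t$ and some path $P$. Let $\mathcal{P}$ be a $(k,d)$-shortcut system for $G$. Then $G^{\mathcal{P}}$ is a subgraph of $J\boxtimes P'\boxtimes K_{d\ell(k^3+3k)}$ for some graph $J$ of treewidth at most $\binom{k+t}{t}-1$ and some path $P'$.
   Context: All graphs are finite and simple. A path of length $m$ has $m$ edges; a path is non-trivial if it has length at least 1. A non-empty set $\mathcal{P}$ of non-trivial paths in a graph $G$ is a $(k,d)$-shortcut system for $G$ if every path in $\mathcal{P}$ has length at most $k$, and for every $v\in V(G)$ the number of paths in $\mathcal{P}$ that contain $v$ as an internal vertex is at most $d$. For such $\mathcal{P}$, $G^{\mathcal{P}}$ is the supergraph of $G$ obtained by adding the edge $vw$ for each path in $\mathcal{P}$ with endpoints $v$ and $w$. The strong product $A\boxtimes B$ has vertex set $V(A)\times V(B)$, with distinct $(v,x),(w,y)$ adjacent if ($v=w$ and $xy\in E(B)$), or ($x=y$ and $vw\in E(A)$), or ($vw\in E(A)$ and $xy\in E(B)$). $K_m$ is the complete graph on $m$ vertices. *)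

theory Defs
  imports Main
begin

type_synonym 'a graph = "'a set \<times> ('a \<times> 'a) set"

definition verts :: "'a graph \<Rightarrow> 'a set" where
  "verts G = fst G"

definition adj :: "'a graph \<Rightarrow> 'a \<Rightarrow> 'a \<Rightarrow> bool" where
  "adj G u v \<longleftrightarrow> (u, v) \<in> snd G"

definition wf_graph :: "'a graph \<Rightarrow> bool" where
  "wf_graph G \<longleftrightarrow> finite (verts G) \<and> snd G \<subseteq> verts G \<times> verts G
     \<and> (\<forall>u v. adj G u v \<longrightarrow> adj G v u) \<and> (\<forall>u. \<not> adj G u u)"

definition is_walk :: "'a graph \<Rightarrow> 'a list \<Rightarrow> bool" where
  "is_walk G xs \<longleftrightarrow> xs \<noteq> [] \<and> set xs \<subseteq> verts G
     \<and> (\<forall>i. i + 1 < length xs \<longrightarrow> adj G (xs ! i) (xs ! (i + 1)))"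

definition is_path_in :: "'a graph \<Rightarrow> 'a list \<Rightarrow> bool" where
  "is_path_in G xs \<longleftrightarrow> is_walk G xs \<and> distinct xs"

definition is_cycle :: "'a graph \<Rightarrow> 'a list \<Rightarrow> bool" where
  "is_cycle G xs \<longleftrightarrow> length xs \<ge> 3 \<and> distinct xs \<and> is_walk G xs \<and> adj G (last xs) (hd xs)"

definition connected_in :: "'a graph \<Rightarrow> 'a set \<Rightarrow> bool" where
  "connected_in G S \<longleftrightarrow> (\<forall>u\<in>S. \<forall>v\<in>S. \<exists>xs. is_walk G xs \<and> set xs \<subseteq> S \<and> hd xs = u \<and> last xs = v)"

definition is_tree :: "'a graph \<Rightarrow> bool" where
  "is_tree T \<longleftrightarrow> wf_graph T \<and> verts T \<noteq> {} \<and> connected_in T (verts T) \<and> (\<nexists>xs. is_cycle T xs)"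

definition is_path_graph :: "'a graph \<Rightarrow> bool" where
  "is_path_graph P \<longleftrightarrow> wf_graph P \<and> (\<exists>xs. xs \<noteq> [] \<and> distinct xs \<and> set xs = verts P \<and>
     (\<forall>u v. adj P u v \<longleftrightarrow> (\<exists>i. i + 1 < length xs \<and>
        ((u = xs ! i \<and> v = xs ! (i + 1)) \<or> (v = xs ! i \<and> u = xs ! (i + 1))))))"

text \<open>Tree decompositions and treewidth (tree nodes indexed by nat; every finite tree is
  isomorphic to one on nat).\<close>
definition tree_decomposition :: "'a graph \<Rightarrow> nat graph \<Rightarrow> (nat \<Rightarrow> 'a set) \<Rightarrow> bool" where
  "tree_decomposition G T B \<longleftrightarrow> is_tree T
     \<and> (\<forall>x\<in>verts T. B x \<subseteq> verts G)
     \<and> (\<forall>v\<in>verts G. \<exists>x\<in>verts T. v \<in> B x)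
     \<and> (\<forall>u v. adj G u v \<longrightarrow> (\<exists>x\<in>verts T. u \<in> B x \<and> v \<in> B x))
     \<and> (\<forall>v\<in>verts G. connected_in T {x\<in>verts T. v \<in> B x})"

definition treewidth_le :: "'a graph \<Rightarrow> nat \<Rightarrow> bool" where
  "treewidth_le G t \<longleftrightarrow> (\<exists>T B. tree_decomposition G T B \<and> (\<forall>x\<in>verts T. card (B x) \<le> t + 1))"

definition strong_prod :: "'a graph \<Rightarrow> 'b graph \<Rightarrow> ('a \<times> 'b) graph" where
  "strong_prod A B = (verts A \<times> verts B,
     {((v, x), (w, y)). v \<in> verts A \<and> w \<in> verts A \<and> x \<in> verts B \<and> y \<in> verts B \<and> (v, x) \<noteq> (w, y) \<and>
        ((v = w \<and> adj B x y) \<or> (x = y \<and> adj A v w) \<or> (adj A v w \<and> adj B x y))})"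

definition complete_graph :: "nat \<Rightarrow> nat graph" where
  "complete_graph m = ({0..<m}, {(i, j). i < m \<and> j < m \<and> i \<noteq> j})"

definition subgraph_of :: "'a graph \<Rightarrow> 'b graph \<Rightarrow> bool" where
  "subgraph_of G X \<longleftrightarrow> (\<exists>f. inj_on f (verts G) \<and> f ` verts G \<subseteq> verts X
     \<and> (\<forall>u v. adj G u v \<longrightarrow> adj X (f u) (f v)))"

definition internal_verts :: "'a list \<Rightarrow> 'a set" where
  "internal_verts p = set (butlast (tl p))"

definition shortcut_system :: "'a graph \<Rightarrow> nat \<Rightarrow> nat \<Rightarrow> 'a list set \<Rightarrow> bool" where
  "shortcut_system G k d PS \<longleftrightarrow> PS \<noteq> {}
     \<and> (\<forall>p\<in>PS. is_path_in G p \<and> 1 \<le> length p - 1 \<and> length p - 1 \<le> k)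
     \<and> (\<forall>v\<in>verts G. card {p\<in>PS. v \<in> internal_verts p} \<le> d)"

definition shortcut_graph :: "'a graph \<Rightarrow> 'a list set \<Rightarrow> 'a graph" where
  "shortcut_graph G PS = (verts G,
     snd G \<union> {(hd p, last p) | p. p \<in> PS} \<union> {(last p, hd p) | p. p \<in> PS})"

end

theory Submission
  imports Defs
begin

text \<open>
  Number the vertices of a chordal supergraph of \<open>H\<close> so that the set \<open>D x\<close> of smaller neighbours of
  \<open>x\<close> is a clique with at most \<open>t\<close> elements. Let \<open>J\<close> join each \<open>x\<close> to the vertices reached from it
  by at most \<open>k\<close> steps along \<open>D\<close>; these sets have at most \<open>k + t choose t\<close> elements and are the
  bags of a tree decomposition of \<open>J\<close>. A vertex \<open>v\<close> of \<open>G\<close> moves from its own node \<open>g v\<close> to the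
  least node \<open>place v\<close> that contains \<open>v\<close> or an internal vertex of a shortcut through \<open>v\<close>, and \<open>k\<close>
  consecutive layers are merged into one. The internal vertices of a shortcut between \<open>v\<close> and \<open>w\<close>
  force the larger one of \<open>place v\<close> and \<open>place w\<close> to reach the smaller one in at most \<open>k\<close> steps.
  A node and a merged layer receive at most \<open>k l\<close> vertices that did not move, and at most
  \<open>3 k l d k\<close> that did, since each of the at most \<open>3 k l\<close> vertices of that node in the layers
  nearby is internal to at most \<open>d\<close> shortcuts. Finally \<open>3 k\<^sup>2 + k \<le> k\<^sup>3 + 3 k\<close>, as the difference
  is \<open>k (k - 1) (k - 2)\<close>.
\<close>

section \<open>Elimination orders and reachability\<close>

text \<open>Ends of descending chains that start at \<open>x\<close> and take each term from
  \<open>D\<close> of the one before. Inserting \<open>x\<close> at every stage makes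
  \<open>k\<close> count at most, rather than exactly, \<open>k\<close> steps.\<close>

primrec reach :: "(nat \<Rightarrow> nat set) \<Rightarrow> nat \<Rightarrow> nat \<Rightarrow> nat set" where
  "reach D 0 x = {x}"
| "reach D (Suc k) x = insert x (\<Union>y\<in>D x. reach D k y)"

lemma self_in_reach [simp]: "x \<in> reach D k x"
  by (cases k) auto

lemma reach_Suc_mono: "reach D k x \<subseteq> reach D (Suc k) x"
proof (induction k arbitrary: x)
  case (Suc k)
  then show ?case by (metis UN_mono insert_mono order_refl reach.simps(2))
qed simp

lemma reach_mono: "i \<le> j \<Longrightarrow> reach D i x \<subseteq> reach D j x"
  by (rule lift_Suc_mono_le[of "\<lambda>k. reach D k x"]) (use reach_Suc_mono in auto)

text \<open>Removing the vertices from the largest number to the smallest is a perfect elimination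
  ordering: at its removal, \<open>x\<close> has exactly the clique \<open>D x\<close> as
  neighbourhood.\<close>

locale elimination_order =
  fixes D :: "nat \<Rightarrow> nat set"
  assumes D_less: "y \<in> D x \<Longrightarrow> y < x"
    and clique: "y \<in> D x \<Longrightarrow> z \<in> D x \<Longrightarrow> y < z \<Longrightarrow> y \<in> D z"
begin

lemma finite_D: "finite (D x)"
  using D_less by (intro finite_subset[of "D x" "{..<x}"]) auto

lemma finite_reach: "finite (reach D k x)"
  by (induction k arbitrary: x) (auto simp: finite_D)

lemma reach_le: "z \<in> reach D k x \<Longrightarrow> z \<le> x"
proof (induction k arbitrary: x)
  case (Suc k)
  then show ?case using D_less by fastforce
qed simp

text \<open>The first step \<open>y\<close> of the chain and \<open>q\<close> both lie in the clique
  \<open>D x\<close>. If \<open>q < y\<close>, then \<open>q\<close> is in \<open>D y\<close> and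
  induction applies at \<open>y\<close>; if \<open>y < q\<close>, the step from \<open>x\<close> to
  \<open>y\<close> is replaced by one from \<open>q\<close> to \<open>y\<close>. Since
  \<open>z \<le> q < x\<close>, the chain does leave \<open>x\<close>.\<close>

lemma reach_skip_step:
  "z \<in> reach D j x \<Longrightarrow> q \<in> D x \<Longrightarrow> z \<le> q \<Longrightarrow> z \<in> reach D j q"
proof (induction j arbitrary: x)
  case 0
  then show ?case using D_less by fastforce
next
  case (Suc j)
  from Suc.prems D_less obtain y where y: "y \<in> D x" "z \<in> reach D j y" by fastforce
  consider "y = q" | "q < y" | "y < q" by linarith
  then show ?case
  proof cases
    case 1
    then show ?thesis using y reach_Suc_mono by blast
  next
    case 2
    then have "q \<in> D y" using clique Suc.prems y by blast
    then show ?thesis using Suc.IH y Suc.prems reach_Suc_mono by blast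
  next
    case 3
    then have "y \<in> D q" using clique Suc.prems y by blast
    then show ?thesis using y by auto
  qed
qed

text \<open>Iterates the single-step version along a chain from \<open>x\<close> to
  \<open>q\<close>. Its vertices stay at or above \<open>q\<close>, hence above \<open>z\<close>,
  and the step count \<open>j\<close> never grows.\<close>

lemma reach_skip:
  "q \<in> reach D i x \<Longrightarrow> z \<in> reach D j x \<Longrightarrow> z \<le> q \<Longrightarrow> z \<in> reach D j q"
proof (induction i arbitrary: x)
  case (Suc i)
  show ?case
  proof (cases "q = x")
    case False
    then obtain y where y: "y \<in> D x" "q \<in> reach D i y" using Suc.prems by auto
    then have "z \<in> reach D j y"
      using reach_skip_step Suc.prems reach_le le_trans by blast
    then show ?thesis using Suc y by blast
  qed (use Suc in simp)
qed simp

text \<open>Moving to a larger neighbour costs one step; moving to a smaller one that is still above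
  \<open>z\<close> costs nothing.\<close>

lemma reach_edge:
  assumes "z \<in> reach D r x" "z \<le> y" "x = y \<or> x \<in> D y \<or> y \<in> D x"
  shows "z \<in> reach D (Suc r) y"
  using assms(3)
proof (elim disjE)
  assume "x \<in> D y"
  then show ?thesis using assms by auto
qed (use assms reach_Suc_mono reach_skip_step in blast)+

text \<open>The case of one step in \<open>reach_skip\<close>: being strictly below \<open>y\<close>
  rules out the trivial chain.\<close>

lemma below_in_D:
  assumes "y \<in> reach D i x" "q \<in> D x" "q < y"
  shows "q \<in> D y"
proof -
  have "q \<in> reach D (Suc 0) x" using assms by auto
  from reach_skip[OF assms(1) this] have "q \<in> reach D (Suc 0) y" using assms(3) by simp
  then show ?thesis using assms(3) by auto
qed

text \<open>Pascal's rule: let \<open>q\<close> be the least element of \<open>D x\<close> above the threshold \<open>m\<close>. What is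
  reached at or below \<open>q\<close> is reached from \<open>q\<close> with one step fewer; above \<open>q\<close> every relevant
  \<open>D y\<close> contains \<open>q\<close>, so the width drops by one when the threshold passes \<open>q\<close>.\<close>

lemma card_reach_above:
  assumes "\<And>i y. y \<in> reach D i x \<Longrightarrow> m \<le> y \<Longrightarrow> card (D y \<inter> {m..}) \<le> s"
  shows "card (reach D k x \<inter> {m..}) \<le> (k + s choose s)"
  using assms
\<comment> \<open>The two recursive calls lower \<open>k\<close> at the start vertex
  \<open>q\<close>, or lower \<open>s\<close> at the threshold \<open>Suc q\<close>.\<close>
proof (induction "k + s" arbitrary: k s x m rule: less_induct)
  case less
  show ?case
  proof (cases "k = 0 \<or> D x \<inter> {m..} = {}")
    case True
    have "reach D k x \<inter> {m..} \<subseteq> {x}"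
    proof
      fix z assume z: "z \<in> reach D k x \<inter> {m..}"
      show "z \<in> {x}"
      proof (rule ccontr)
        assume "z \<notin> {x}"
        then obtain k' y where "k = Suc k'" "y \<in> D x" "z \<in> reach D k' y"
          using z by (cases k) auto
        then show False using True z reach_le by fastforce
      qed
    qed
    then have "card (reach D k x \<inter> {m..}) \<le> 1"
      using card_mono[of "{x}"] by fastforce
    also have "1 \<le> (k + s choose s)" by (simp add: Suc_leI)
    finally show ?thesis .
  next
    case False
    then obtain k' where k: "k = Suc k'" by (cases k) auto
    define q where "q = Min (D x \<inter> {m..})"
    have q: "q \<in> D x" "m \<le> q" "\<And>y. y \<in> D x \<Longrightarrow> m \<le> y \<Longrightarrow> q \<le> y"
      using False Min_in[of "D x \<inter> {m..}"] finite_D unfolding q_def by auto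
    have qx: "q < x" using q(1) D_less by blast
    have "card (D x \<inter> {m..}) \<le> s" using less.prems[of x 0] q qx by simp
    then obtain s' where s: "s = Suc s'" using False finite_D by (cases s) auto
    have sub: "reach D k x \<inter> {m..} \<subseteq> (reach D k' q \<inter> {m..}) \<union> (reach D k x \<inter> {Suc q..})"
    proof
      fix z assume z: "z \<in> reach D k x \<inter> {m..}"
      show "z \<in> (reach D k' q \<inter> {m..}) \<union> (reach D k x \<inter> {Suc q..})"
      proof (cases "z \<le> q")
        case True
        then obtain y where y: "y \<in> D x" "z \<in> reach D k' y" using z k qx by auto
        then have "m \<le> y" using z reach_le[OF y(2)] by simp
        then have "q \<le> y" using q(3) y(1) by blast
        moreover have "q \<in> D y" if "q < y" using that clique[OF q(1) y(1)] by blast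
        ultimately have "z \<in> reach D k' q"
          using reach_skip_step[OF y(2) _ True] y(2) by (cases "q = y") auto
        then show ?thesis using z by blast
      qed (use z in auto)
    qed
    \<comment> \<open>The hypothesis ranges over all \<open>i\<close>, so it passes from
      \<open>x\<close> to \<open>q\<close> with \<open>i\<close> shifted by one.\<close>
    have "card (reach D k' q \<inter> {m..}) \<le> (k' + s choose s)"
    proof (rule less.hyps)
      fix i y assume "y \<in> reach D i q" "m \<le> y"
      moreover have "reach D i q \<subseteq> reach D (Suc i) x" using q(1) by auto
      ultimately show "card (D y \<inter> {m..}) \<le> s" using less.prems by blast
    qed (simp add: k)
    moreover have "card (reach D k x \<inter> {Suc q..}) \<le> (k + s' choose s')"
    proof (rule less.hyps)
      fix i y assume y: "y \<in> reach D i x" "Suc q \<le> y"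
      then have "q \<in> D y" using below_in_D q(1) by simp
      then have "q \<in> D y \<inter> {m..} - D y \<inter> {Suc q..}" using q(2) by simp
      moreover have "D y \<inter> {Suc q..} \<subseteq> D y \<inter> {m..}" using q(2) by auto
      ultimately have "D y \<inter> {Suc q..} \<subset> D y \<inter> {m..}" by blast
      then have "card (D y \<inter> {Suc q..}) < card (D y \<inter> {m..})"
        by (intro psubset_card_mono) (auto simp: finite_D)
      also have "\<dots> \<le> s" using less.prems y q(2) by simp
      finally show "card (D y \<inter> {Suc q..}) \<le> s'" using s by simp
    qed (simp add: s)
    moreover have "card (reach D k x \<inter> {m..})
        \<le> card (reach D k' q \<inter> {m..}) + card (reach D k x \<inter> {Suc q..})"
      using card_mono[OF _ sub] finite_reach card_Un_le le_trans by (meson finite_Int finite_UnI)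
    ultimately show ?thesis by (simp add: k s)
  qed
qed

lemma card_reach:
  assumes "\<And>x. card (D x) \<le> t"
  shows "card (reach D k x) \<le> (k + t choose t)"
  using card_reach_above[of x 0 t k] assms by (simp add: atLeast_0)

end

section \<open>From tree decompositions to elimination orders\<close>

lemma is_walk_Cons_Cons:
  "is_walk G (x # y # ys) \<longleftrightarrow> x \<in> verts G \<and> adj G x y \<and> is_walk G (y # ys)"
proof -
  have "(\<forall>i. i + 1 < length (x # y # ys) \<longrightarrow> adj G ((x # y # ys) ! i) ((x # y # ys) ! (i + 1)))
    \<longleftrightarrow> adj G x y \<and> (\<forall>i. i + 1 < length (y # ys) \<longrightarrow> adj G ((y # ys) ! i) ((y # ys) ! (i + 1)))"
    by (auto simp: less_Suc_eq_0_disj nth_Cons split: nat.split)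
  then show ?thesis unfolding is_walk_def by auto
qed


text \<open>Trades walks given as lists for a transitive closure, so that connectivity can be
  treated by closure induction.\<close>

lemma connected_in_iff_rtrancl:
  assumes "S \<subseteq> verts G"
  shows "connected_in G S \<longleftrightarrow>
    (\<forall>u\<in>S. \<forall>v\<in>S. (u, v) \<in> {(a, b). a \<in> S \<and> b \<in> S \<and> adj G a b}\<^sup>*)"
    (is "_ \<longleftrightarrow> (\<forall>u\<in>S. \<forall>v\<in>S. (u, v) \<in> ?R\<^sup>*)")
proof
  have *: "(hd xs, last xs) \<in> ?R\<^sup>*" if "is_walk G xs" "set xs \<subseteq> S" for xs
    using that
  proof (induction xs rule: induct_list012)
    case (3 x y ys)
    then have "(x, y) \<in> ?R" "(y, last (y # ys)) \<in> ?R\<^sup>*" by (auto simp: is_walk_Cons_Cons)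
    then have "(x, last (y # ys)) \<in> ?R\<^sup>*" by (rule converse_rtrancl_into_rtrancl)
    then show ?case by simp
  qed (auto simp: is_walk_def)
  show "\<forall>u\<in>S. \<forall>v\<in>S. (u, v) \<in> ?R\<^sup>*" if "connected_in G S"
  proof (intro ballI)
    fix u v assume "u \<in> S" "v \<in> S"
    then obtain xs where "is_walk G xs" "set xs \<subseteq> S" "hd xs = u" "last xs = v"
      using \<open>connected_in G S\<close> unfolding connected_in_def by blast
    then show "(u, v) \<in> ?R\<^sup>*" using *[of xs] by simp
  qed
next
  have *: "\<exists>xs. is_walk G xs \<and> set xs \<subseteq> S \<and> hd xs = u \<and> last xs = v"
    if "(u, v) \<in> ?R\<^sup>*" "v \<in> S" for u v
    using that(1)
  proof (induction rule: converse_rtrancl_induct)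
    case base
    show ?case using that(2) assms by (intro exI[of _ "[v]"]) (auto simp: is_walk_def)
  next
    case (step y z)
    then obtain xs where xs: "is_walk G xs" "set xs \<subseteq> S" "hd xs = z" "last xs = v" by blast
    then obtain zs where "xs = z # zs" by (cases xs) (auto simp: is_walk_def)
    then show ?case using xs step.hyps assms
      by (intro exI[of _ "y # xs"]) (auto simp: is_walk_Cons_Cons)
  qed
  show "connected_in G S" if "\<forall>u\<in>S. \<forall>v\<in>S. (u, v) \<in> ?R\<^sup>*"
    using that * unfolding connected_in_def by blast
qed

section \<open>Leaves of finite trees and their removal\<close>

lemma wf_graph_adjD:
  assumes "wf_graph G" "adj G u v"
  shows "u \<in> verts G" "v \<in> verts G" "adj G v u" "u \<noteq> v"
  using assms unfolding wf_graph_def by (auto simp: adj_def)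

text \<open>The first vertex of a longest path is a leaf: by maximality all its neighbours lie on
  the path, and any neighbour but the second vertex would close a cycle.\<close>

lemma tree_has_leaf:
  assumes T: "is_tree T" and two: "card (verts T) \<ge> 2"
  obtains x p where "x \<in> verts T" "p \<in> verts T" "x \<noteq> p" "\<And>y. adj T x y \<longleftrightarrow> y = p"
proof -
  have wf: "wf_graph T" and fin: "finite (verts T)" using T by (auto simp: is_tree_def wf_graph_def)
  let ?paths = "{xs. is_path_in T xs}"
  have "?paths \<subseteq> {xs. set xs \<subseteq> verts T \<and> distinct xs}"
    by (auto simp: is_path_in_def is_walk_def)
  then have finp: "finite ?paths" using finite_subset finite_subset_distinct[OF fin] by blast
  obtain a b where ab: "a \<in> verts T" "b \<in> verts T" "a \<noteq> b"
    using two by (metis card_le_Suc0_iff_eq fin not_less_eq_eq numeral_2_eq_2)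
  then have "(a, b) \<in> {(a, b). a \<in> verts T \<and> b \<in> verts T \<and> adj T a b}\<^sup>*"
    using T connected_in_iff_rtrancl[of "verts T" T] by (auto simp: is_tree_def)
  then obtain c where "adj T a c" using ab(3) by (auto elim: converse_rtranclE)
  then have ac: "is_path_in T [a, c]"
    using wf_graph_adjD[OF wf \<open>adj T a c\<close>]
    by (auto simp: is_path_in_def is_walk_Cons_Cons) (simp add: is_walk_def)
  obtain xs where xs: "is_path_in T xs" and max: "\<And>ys. is_path_in T ys \<Longrightarrow> length ys \<le> length xs"
    using finp ac Max_in[of "length ` ?paths"] Max_ge[of "length ` ?paths"] by fastforce
  have "length xs \<ge> 2" using max[OF ac] by simp
  then obtain x p zs where xs_eq: "xs = x # p # zs"
    by (cases xs; cases "tl xs") auto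
  have walk: "is_walk T xs" and dist: "distinct xs" using xs by (auto simp: is_path_in_def)
  have xp: "adj T x p" using walk by (simp add: xs_eq is_walk_Cons_Cons)
  have "y = p" if y: "adj T x y" for y
  proof (rule ccontr)
    assume "y \<noteq> p"
    have "y \<in> set xs"
    proof (rule ccontr)
      assume "y \<notin> set xs"
      then have "is_path_in T (y # xs)"
        using xs wf_graph_adjD[OF wf y] by (auto simp: is_path_in_def xs_eq is_walk_Cons_Cons)
      then show False using max by force
    qed
    then obtain i where i: "i < length xs" "xs ! i = y" by (auto simp: in_set_conv_nth)
    have "i \<noteq> 0" using i wf_graph_adjD(4)[OF wf y] by (intro notI) (simp add: xs_eq)
    moreover have "i \<noteq> 1" using i \<open>y \<noteq> p\<close> by (intro notI) (simp add: xs_eq)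
    ultimately have i2: "i \<ge> 2" by simp
    \<comment> \<open>As \<open>i\<close> is at least 2, this segment has the three vertices that a
      cycle requires.\<close>
    let ?c = "take (Suc i) xs"
    have "is_walk T ?c" using walk i by (auto simp: is_walk_def dest: in_set_takeD)
    moreover have "last ?c = y" using i by (simp add: take_Suc_conv_app_nth)
    moreover have "hd ?c = x" by (simp add: xs_eq)
    ultimately have "is_cycle T ?c"
      using i i2 dist wf_graph_adjD[OF wf y] by (auto simp: is_cycle_def)
    then show False using T by (auto simp: is_tree_def)
  qed
  then show thesis using that[of x p] xp wf_graph_adjD[OF wf xp] by blast
qed

definition delete_vertex :: "'a graph \<Rightarrow> 'a \<Rightarrow> 'a graph" where
  "delete_vertex G x = (verts G - {x}, {(a, b). adj G a b \<and> a \<noteq> x \<and> b \<noteq> x})"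

lemma delete_vertex_simps [simp]:
  "verts (delete_vertex G x) = verts G - {x}"
  "adj (delete_vertex G x) a b \<longleftrightarrow> adj G a b \<and> a \<noteq> x \<and> b \<noteq> x"
  by (auto simp: delete_vertex_def verts_def adj_def)

lemma connected_in_delete_leaf:
  assumes wf: "wf_graph T" and leaf: "\<And>y. adj T x y \<longleftrightarrow> y = p"
    and S: "S \<subseteq> verts T" "connected_in T S"
  shows "connected_in (delete_vertex T x) (S - {x})"
proof -
  let ?R = "{(a, b). a \<in> S \<and> b \<in> S \<and> adj T a b}"
  let ?R' = "{(a, b). a \<in> S - {x} \<and> b \<in> S - {x} \<and> adj (delete_vertex T x) a b}"
  \<comment> \<open>Whenever the walk stands at the leaf, \<open>p\<close> is recorded instead.
    Entering and leaving \<open>x\<close> both happen through \<open>p\<close>, so these steps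
    become stationary.\<close>
  have *: "(u, if v = x then p else v) \<in> ?R'\<^sup>*" if "(u, v) \<in> ?R\<^sup>*" "u \<noteq> x" for u v
    using that
  proof (induction rule: rtrancl_induct)
    case (step y z)
    have yz: "adj T y z" "y \<in> S" "z \<in> S" using step.hyps by auto
    then have zy: "adj T z y" using wf wf_graph_adjD by metis
    consider "y = x" | "z = x" | "y \<noteq> x" "z \<noteq> x" by blast
    then show ?case
    proof cases
      case 3
      then have "(y, z) \<in> ?R'" using yz by auto
      then show ?thesis using step 3 by (auto intro: rtrancl_into_rtrancl)
    qed (use step leaf yz zy wf_graph_adjD(4)[OF wf zy] in auto)
  qed auto
  have "(u, v) \<in> ?R'\<^sup>*" if "u \<in> S - {x}" "v \<in> S - {x}" for u v
  proof -
    have "(u, v) \<in> ?R\<^sup>*" using that S connected_in_iff_rtrancl[of S T] by blast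
    then show ?thesis using *[of u v] that by simp
  qed
  then show ?thesis
    using S by (subst connected_in_iff_rtrancl) auto
qed

lemma is_tree_delete_leaf:
  assumes T: "is_tree T" and p: "p \<in> verts T" "x \<noteq> p" and leaf: "\<And>y. adj T x y \<longleftrightarrow> y = p"
  shows "is_tree (delete_vertex T x)"
proof -
  have wf: "wf_graph T" using T by (simp add: is_tree_def)
  have "is_cycle T xs" if "is_cycle (delete_vertex T x) xs" for xs
    using that by (auto simp: is_cycle_def is_walk_def)
  moreover have "wf_graph (delete_vertex T x)"
    using wf wf_graph_adjD[OF wf] unfolding wf_graph_def
    by (auto simp: delete_vertex_def adj_def verts_def)
  moreover have "connected_in (delete_vertex T x) (verts T - {x})"
    using connected_in_delete_leaf[OF wf leaf] T by (simp add: is_tree_def)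
  ultimately show ?thesis
    using T p by (auto simp: is_tree_def)
qed

section \<open>Turning the bags of a tree decomposition into cliques\<close>

text \<open>Every member of the family \<open>C\<close> becomes a clique of the order. The bound
  \<open>n\<close> marks where fresh numbers may start when a further bag is added.\<close>

definition clique_numbering ::
  "nat \<Rightarrow> 'a set set \<Rightarrow> ('a \<Rightarrow> nat) \<Rightarrow> (nat \<Rightarrow> nat set) \<Rightarrow> nat \<Rightarrow> bool" where
  "clique_numbering t C f D n \<longleftrightarrow> inj_on f (\<Union>C) \<and> f ` \<Union>C \<subseteq> {..<n} \<and> elimination_order D
     \<and> (\<forall>x. card (D x) \<le> t) \<and> (\<forall>K\<in>C. \<forall>u\<in>K. \<forall>v\<in>K. f u < f v \<longrightarrow> f u \<in> D (f v))"

text \<open>Vertices new in \<open>K\<close> are numbered from \<open>n\<close> on, and each takes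
  the smaller members of \<open>K\<close> as its \<open>D\<close>. By \<open>sep\<close>, any two
  old members of \<open>K\<close> already share a clique, so the sets \<open>D i\<close> below
  \<open>n\<close> stay as they are.\<close>

lemma clique_numbering_insert:
  assumes C: "clique_numbering t C f D n"
    and K: "finite K" "card K \<le> t + 1"
    and sep: "\<And>u v. u \<in> K \<inter> \<Union>C \<Longrightarrow> v \<in> K \<inter> \<Union>C \<Longrightarrow> \<exists>K'\<in>C. u \<in> K' \<and> v \<in> K'"
  shows "\<exists>f' D' n'. clique_numbering t (insert K C) f' D' n'"
proof -
  interpret elimination_order D using C by (simp add: clique_numbering_def)
  have inj: "inj_on f (\<Union>C)" and fn: "\<And>v. v \<in> \<Union>C \<Longrightarrow> f v < n"
    and card_D: "\<And>x. card (D x) \<le> t"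
    and cl: "\<And>K u v. K \<in> C \<Longrightarrow> u \<in> K \<Longrightarrow> v \<in> K \<Longrightarrow> f u < f v \<Longrightarrow> f u \<in> D (f v)"
    using C unfolding clique_numbering_def by auto
  define N where "N = K - \<Union>C"
  have "finite N" using K by (simp add: N_def)
  then obtain e where e: "bij_betw e N {0..<card N}"
    using ex_bij_betw_finite_nat by blast
  define f' where "f' v = (if v \<in> N then n + e v else f v)" for v
  \<comment> \<open>Numbers beyond the new vertices get the empty set, so that the width bound holds
    at every natural number.\<close>
  define D' where "D' i = (if i < n then D i else if i < n + card N then {f' u |u. u \<in> K \<and> f' u < i} else {})" for i
  have new: "n \<le> f' v" "f' v < n + card N" if "v \<in> N" for v
    using that e by (auto simp: f'_def bij_betw_def)
  have old: "f' v = f v" "f' v < n" if "v \<in> \<Union>C" for v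
    using that fn by (auto simp: f'_def N_def)
  have cover: "v \<in> N \<or> v \<in> \<Union>C" if "v \<in> K" for v using that by (auto simp: N_def)
  have inj': "inj_on f' (\<Union>(insert K C))"
  proof (rule inj_onI)
    fix u v assume uv: "u \<in> \<Union>(insert K C)" "v \<in> \<Union>(insert K C)" "f' u = f' v"
    then have "u \<in> N \<longleftrightarrow> v \<in> N" using new old cover
      by (metis UnionE UnionI insert_iff not_less)
    moreover have "inj_on e N" using e by (simp add: bij_betw_def)
    moreover have "u \<in> \<Union>C \<and> v \<in> \<Union>C" if "u \<notin> N" "v \<notin> N" using that uv cover by auto
    ultimately show "u = v" using uv inj
      by (cases "u \<in> N") (auto simp only: f'_def if_True if_False add_left_cancel dest: inj_onD)
  qed
  have K_cl: "f' u \<in> D' (f' v)" if "u \<in> K" "v \<in> K" "f' u < f' v" for u v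
  proof (cases "v \<in> N")
    case True
    then show ?thesis using that new[of v] by (auto simp: D'_def)
  next
    case False
    then have v: "v \<in> \<Union>C" using cover that by blast
    \<comment> \<open>A new \<open>u\<close> would have a number at least \<open>n\<close>, hence
      above that of the old \<open>v\<close>.\<close>
    then have u: "u \<in> \<Union>C" using cover that new[of u] old(2)[of v] by fastforce
    then obtain K' where "K' \<in> C" "u \<in> K'" "v \<in> K'" using sep u v \<open>u \<in> K\<close> \<open>v \<in> K\<close> by blast
    then show ?thesis using cl old u v that(3) by (auto simp: D'_def)
  qed
  have "elimination_order D'"
  proof
    show "y < x" if "y \<in> D' x" for x y
      using that D_less by (auto simp: D'_def split: if_splits)
    show "y \<in> D' z" if yz: "y \<in> D' x" "z \<in> D' x" "y < z" for x y z
    proof (cases "x < n")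
      case True
      then have "y \<in> D x" "z \<in> D x" using yz by (simp_all add: D'_def)
      moreover from this have "z < n" using D_less[of z x] True by simp
      ultimately show ?thesis using clique[of y x z] yz(3) by (simp add: D'_def)
    next
      case False
      then obtain u w where "u \<in> K" "w \<in> K" "y = f' u" "z = f' w"
        using yz by (auto simp: D'_def split: if_splits)
      then show ?thesis using yz(3) K_cl by blast
    qed
  qed
  moreover have "card (D' i) \<le> t" for i
  proof (cases "n \<le> i \<and> i < n + card N")
    case True
    then have "i - n \<in> e ` N" using e by (auto simp: bij_betw_def)
    then obtain v where v: "v \<in> N" "f' v = i" using True by (auto simp: f'_def)
    \<comment> \<open>The vertex \<open>v\<close> is not below itself; this turns the bag size
      \<open>t + 1\<close> into the width \<open>t\<close>.\<close>
    have "D' i \<subseteq> f' ` (K - {v})" using True v by (auto simp: D'_def)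
    then have "card (D' i) \<le> card (K - {v})"
      using K by (meson card_image_le card_mono finite_Diff finite_imageI le_trans)
    then show ?thesis using K v by (simp add: N_def)
  qed (use card_D in \<open>auto simp: D'_def\<close>)
  moreover have "f' u \<in> D' (f' v)" if "K' \<in> C" "u \<in> K'" "v \<in> K'" "f' u < f' v" for K' u v
  proof -
    have "u \<in> \<Union>C" "v \<in> \<Union>C" using that by auto
    then show ?thesis using old[of u] old[of v] that cl by (auto simp: D'_def)
  qed
  moreover have "f' ` \<Union>(insert K C) \<subseteq> {..<n + card N}"
    using new old cover by fastforce
  ultimately have "clique_numbering t (insert K C) f' D' (n + card N)"
    using inj' K_cl unfolding clique_numbering_def by auto
  then show ?thesis by blast
qed

text \<open>Induction on the tree: number the bags without those of a leaf \<open>x\<close>, then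
  add \<open>B x\<close>. What \<open>B x\<close> shares with the other bags lies in the bag of the
  neighbour \<open>p\<close>, which supplies the common clique.\<close>

lemma tree_bags_clique_numbering:
  assumes "is_tree T"
    and "\<And>x. x \<in> verts T \<Longrightarrow> finite (B x) \<and> card (B x) \<le> t + 1"
    and "\<And>v. connected_in T {x \<in> verts T. v \<in> B x}"
  shows "\<exists>f D n. clique_numbering t (B ` verts T) f D n"
  using assms
proof (induction "card (verts T)" arbitrary: T rule: less_induct)
  case less
  have wf: "wf_graph T" and fin: "finite (verts T)" and ne: "verts T \<noteq> {}"
    using less.prems(1) by (auto simp: is_tree_def wf_graph_def)
  show ?case
  proof (cases "card (verts T) \<ge> 2")
    case False
    then have "card (verts T) = 1" using fin ne by (metis One_nat_def Suc_1 Suc_leI card_gt_0_iff le_neq_implies_less not_less_eq_eq)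
    then obtain x where x: "verts T = {x}" using card_1_singletonE by blast
    have "clique_numbering t {} (\<lambda>_. 0) (\<lambda>_. {}) 0"
      by (auto simp: clique_numbering_def elimination_order_def)
    from clique_numbering_insert[OF this, of "B x"] show ?thesis using less.prems(2)[of x] x by auto
  next
    case True
    then obtain x p where xp: "x \<in> verts T" "p \<in> verts T" "x \<noteq> p" "\<And>y. adj T x y \<longleftrightarrow> y = p"
      using tree_has_leaf[OF less.prems(1)] by metis
    let ?T = "delete_vertex T x"
    have "\<exists>f D n. clique_numbering t (B ` verts ?T) f D n"
    proof (rule less.hyps)
      show "card (verts ?T) < card (verts T)" using xp fin by (simp add: card_gt_0_iff card_Diff1_less del: card_Diff_insert card_Diff_singleton)
      show "is_tree ?T" using is_tree_delete_leaf less.prems(1) xp by metis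
      show "connected_in ?T {y \<in> verts ?T. v \<in> B y}" for v
      proof -
        have "{y \<in> verts ?T. v \<in> B y} = {y \<in> verts T. v \<in> B y} - {x}" by auto
        then show ?thesis
          using connected_in_delete_leaf[OF wf xp(4) _ less.prems(3)[of v]] by simp
      qed
    qed (use less.prems(2) in auto)
    then obtain f D n where f: "clique_numbering t (B ` verts ?T) f D n" by blast
    \<comment> \<open>The nodes whose bags contain \<open>v\<close> are connected, so a walk from
      \<open>x\<close> to another of them starts with a step to \<open>p\<close>.\<close>
    have "v \<in> B p" if v: "v \<in> B x \<inter> \<Union>(B ` verts ?T)" for v
    proof -
      let ?S = "{y \<in> verts T. v \<in> B y}"
      obtain y where y: "y \<in> verts T" "y \<noteq> x" "v \<in> B y" using v by auto
      then have "(x, y) \<in> {(a, b). a \<in> ?S \<and> b \<in> ?S \<and> adj T a b}\<^sup>*"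
        using less.prems(3)[of v] connected_in_iff_rtrancl[of ?S T] v xp by auto
      then show ?thesis using y(2) xp(4) by (auto elim: converse_rtranclE)
    qed
    moreover have "p \<in> verts ?T" using xp by simp
    ultimately have "\<exists>f' D' n'. clique_numbering t (insert (B x) (B ` verts ?T)) f' D' n'"
      using less.prems(2)[OF xp(1)] by (intro clique_numbering_insert[OF f]) blast+
    moreover have "insert (B x) (B ` verts ?T) = B ` verts T" using xp(1) by auto
    ultimately show ?thesis by simp
  qed
qed

lemma treewidth_le_elimination_order:
  assumes "wf_graph H" "treewidth_le H t"
  obtains f :: "'a \<Rightarrow> nat" and D n where "inj_on f (verts H)" "f ` verts H \<subseteq> {..<n}"
    "elimination_order D" "\<And>x. card (D x) \<le> t"
    "\<And>u v. adj H u v \<Longrightarrow> f u \<in> D (f v) \<or> f v \<in> D (f u)"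
proof -
  obtain T B where TB: "tree_decomposition H T B" "\<forall>x\<in>verts T. card (B x) \<le> t + 1"
    using assms(2) by (auto simp: treewidth_le_def)
  have fin: "finite (verts H)" using assms(1) by (simp add: wf_graph_def)
  \<comment> \<open>For \<open>v\<close> outside \<open>H\<close> the node set is empty and so
    connected; the numbering lemma asks for all \<open>v\<close>.\<close>
  have conn: "connected_in T {x \<in> verts T. v \<in> B x}" for v
  proof (cases "v \<in> verts H")
    case False
    then have "{x \<in> verts T. v \<in> B x} = {}" using TB by (auto simp: tree_decomposition_def)
    then show ?thesis unfolding connected_in_def by blast
  qed (use TB in \<open>auto simp: tree_decomposition_def\<close>)
  have bag: "finite (B x) \<and> card (B x) \<le> t + 1" if "x \<in> verts T" for x
    using that TB fin finite_subset unfolding tree_decomposition_def by metis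
  have tree: "is_tree T" using TB(1) by (simp add: tree_decomposition_def)
  obtain f D n where *: "clique_numbering t (B ` verts T) f D n"
    using tree_bags_clique_numbering[OF tree bag conn] by blast
  have un: "\<Union>(B ` verts T) = verts H" using TB(1) by (auto simp: tree_decomposition_def)
  have "f u \<in> D (f v) \<or> f v \<in> D (f u)" if uv: "adj H u v" for u v
  proof -
    obtain x where x: "x \<in> verts T" "u \<in> B x" "v \<in> B x"
      using TB(1) uv unfolding tree_decomposition_def by blast
    have "f u \<noteq> f v" using * un wf_graph_adjD[OF assms(1) uv]
      by (auto simp: clique_numbering_def inj_on_def)
    then show ?thesis using * x unfolding clique_numbering_def
      by (metis imageI linorder_neqE_nat)
  qed
  then show thesis using that[of f n D] * un by (auto simp: clique_numbering_def)
qed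


section \<open>The treewidth of the reachability graph\<close>

text \<open>A tree rooted at \<open>0\<close>; \<open>par\<close> is consulted at positive numbers
  only. Taking \<open>n\<close> itself as a node keeps the tree non-empty.\<close>

definition parent_tree :: "(nat \<Rightarrow> nat) \<Rightarrow> nat \<Rightarrow> nat graph" where
  "parent_tree par n = ({..n}, {(x, y). x \<le> n \<and> y \<le> n \<and> (0 < x \<and> y = par x \<or> 0 < y \<and> x = par y)})"

lemma verts_parent_tree [simp]: "verts (parent_tree par n) = {..n}"
  and adj_parent_tree: "adj (parent_tree par n) x y \<longleftrightarrow>
    x \<le> n \<and> y \<le> n \<and> (0 < x \<and> y = par x \<or> 0 < y \<and> x = par y)"
  by (auto simp: parent_tree_def verts_def adj_def)

text \<open>Following parents from any element stays in \<open>S\<close>, strictly decreases, and so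
  ends at \<open>r\<close>.\<close>

lemma connected_in_parent_tree:
  assumes par: "\<And>x. 0 < x \<Longrightarrow> par x < x"
    and S: "S \<subseteq> {..n}" "r \<in> S" "\<And>x. x \<in> S \<Longrightarrow> x \<noteq> r \<Longrightarrow> 0 < x \<and> par x \<in> S"
  shows "connected_in (parent_tree par n) S"
proof -
  let ?R = "{(a, b). a \<in> S \<and> b \<in> S \<and> adj (parent_tree par n) a b}"
  have root: "(x, r) \<in> ?R\<^sup>*" if "x \<in> S" for x
    using that
  proof (induction x rule: less_induct)
    case (less x)
    show ?case
    proof (cases "x = r")
      case False
      then have x: "0 < x" "par x \<in> S" using S less.prems by auto
      then have "(x, par x) \<in> ?R" using less.prems S(1) by (auto simp: adj_parent_tree)
      then show ?thesis using less.IH[OF par[OF x(1)] x(2)]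
        by (rule converse_rtrancl_into_rtrancl)
    qed simp
  qed
  have sym: "sym ?R" by (auto simp: sym_def adj_parent_tree)
  have "(r, x) \<in> ?R\<^sup>*" if "x \<in> S" for x
    by (rule symD[OF sym_rtrancl[OF sym] root[OF that]])
  then have "(x, y) \<in> ?R\<^sup>*" if "x \<in> S" "y \<in> S" for x y
    using rtrancl_trans[OF root[OF that(1)]] that(2) by blast
  then show ?thesis using S(1) by (subst connected_in_iff_rtrancl) auto
qed

lemma is_tree_parent_tree:
  assumes par: "\<And>x. 0 < x \<Longrightarrow> par x < x"
  shows "is_tree (parent_tree par n)"
proof -
  let ?T = "parent_tree par n"
  have par_le: "par x \<le> n" if "0 < x" "x \<le> n" for x using par[OF that(1)] that(2) by simp
  have irrefl: "\<not> adj ?T x x" for x using par[of x] by (auto simp: adj_parent_tree)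
  have sym: "adj ?T x y \<Longrightarrow> adj ?T y x" for x y by (auto simp: adj_parent_tree)
  have "wf_graph ?T"
    using irrefl sym unfolding wf_graph_def
    by (auto simp: adj_parent_tree) (auto simp: parent_tree_def)
  moreover have "connected_in ?T {..n}"
    by (rule connected_in_parent_tree[where r = 0]) (use par par_le in auto)
  moreover have False if cyc: "is_cycle ?T xs" for xs
  proof -
    have len: "length xs \<ge> 3" and dist: "distinct xs"
      and closing: "adj ?T (last xs) (hd xs)"
      and step: "\<And>i. i + 1 < length xs \<Longrightarrow> adj ?T (xs ! i) (xs ! (i + 1))"
      using cyc by (auto simp: is_cycle_def is_walk_def)
    have ne: "xs \<noteq> []" using len by auto
    have "Max (set xs) \<in> set xs" using ne by simp
    then obtain m where m: "m < length xs" "xs ! m = Max (set xs)" by (auto simp: in_set_conv_nth)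
    \<comment> \<open>Both cyclic neighbours of the largest vertex would have to be its parent.\<close>
    have down: "xs ! j = par (xs ! m)" if "j < length xs" "adj ?T (xs ! m) (xs ! j)" for j
    proof -
      have "xs ! j \<le> xs ! m" using that m by simp
      then show ?thesis using that(2) par[of "xs ! j"] by (auto simp: adj_parent_tree)
    qed
    \<comment> \<open>The cyclic predecessor and successor of position \<open>m\<close>; they differ
      because the cycle has at least three vertices.\<close>
    define i where "i = (if m = 0 then length xs - 1 else m - 1)"
    define j where "j = (if m = length xs - 1 then 0 else m + 1)"
    have ij: "i < length xs" "j < length xs" "i \<noteq> j" using len m by (auto simp: i_def j_def)
    have "adj ?T (xs ! m) (xs ! i)"
      using step[of "m - 1"] closing sym m ne by (auto simp: i_def last_conv_nth hd_conv_nth)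
    moreover have "adj ?T (xs ! m) (xs ! j)"
      using step[of m] closing m ne by (auto simp: j_def last_conv_nth hd_conv_nth)
    ultimately have "xs ! i = xs ! j" using down[of i] down[of j] ij by (simp only:)
    then show False using dist ij by (simp add: nth_eq_iff_index_eq)
  qed
  ultimately show ?thesis unfolding is_tree_def by auto
qed

definition reach_graph :: "(nat \<Rightarrow> nat set) \<Rightarrow> nat \<Rightarrow> nat \<Rightarrow> nat graph" where
  "reach_graph D k n = ({..n}, {(x, y). x \<le> n \<and> y \<le> n \<and> x \<noteq> y \<and> (x \<in> reach D k y \<or> y \<in> reach D k x)})"

lemma verts_reach_graph [simp]: "verts (reach_graph D k n) = {..n}"
  and adj_reach_graph: "adj (reach_graph D k n) x y \<longleftrightarrow>
    x \<le> n \<and> y \<le> n \<and> x \<noteq> y \<and> (x \<in> reach D k y \<or> y \<in> reach D k x)"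
  by (auto simp: reach_graph_def verts_def adj_def)

lemma wf_reach_graph: "wf_graph (reach_graph D k n)"
  unfolding wf_graph_def by (auto simp: adj_reach_graph) (auto simp: reach_graph_def)

context elimination_order
begin

text \<open>The bag at \<open>x\<close> is \<open>reach D k x\<close> and the parent of
  \<open>x\<close> is the largest element of \<open>D x\<close>. If \<open>z\<close> is reached from
  \<open>x\<close> through \<open>y\<close> in \<open>D x\<close>, then
  \<open>z \<le> y \<le> par x\<close>, so \<open>reach_skip_step\<close> puts \<open>z\<close> in
  the bag of \<open>par x\<close>; thus the bags with \<open>z\<close> form a subtree with root
  \<open>z\<close>.\<close>

lemma treewidth_reach_graph:
  assumes "\<And>x. card (D x) \<le> t"
  shows "treewidth_le (reach_graph D k n) ((k + t choose t) - 1)"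
proof -
  \<comment> \<open>The inserted \<open>0\<close> attaches vertices with empty \<open>D x\<close> to
    the root.\<close>
  define par where "par x = Max (insert 0 (D x))" for x
  have par: "par x < x" if "0 < x" for x
    using that D_less by (simp add: par_def finite_D)
  have conn: "connected_in (parent_tree par n) {x \<in> {..n}. z \<in> reach D k x}" if "z \<le> n" for z
  proof (rule connected_in_parent_tree[OF par])
    fix x assume x: "x \<in> {x \<in> {..n}. z \<in> reach D k x}" "x \<noteq> z"
    then obtain k' y where y: "y \<in> D x" "z \<in> reach D k' y" by (cases k) auto
    have "x > 0" using D_less[OF y(1)] by simp
    have "par x = Max (D x)" using y(1) finite_D unfolding par_def
      by (subst Max_insert) auto
    then have "par x \<in> D x" "y \<le> par x" using y(1) finite_D by (auto intro: Max_in)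
    then have "z \<in> reach D k (par x)"
      using x(1) reach_skip_step reach_le[OF y(2)] by auto
    then show "0 < x \<and> par x \<in> {x \<in> {..n}. z \<in> reach D k x}"
      using \<open>x > 0\<close> par[OF \<open>x > 0\<close>] x(1) by simp
  qed (use that in auto)
  have "tree_decomposition (reach_graph D k n) (parent_tree par n) (reach D k)"
    unfolding tree_decomposition_def
  proof (intro conjI)
    show "\<forall>x\<in>verts (parent_tree par n). reach D k x \<subseteq> verts (reach_graph D k n)"
      using reach_le by fastforce
    show "\<forall>u v. adj (reach_graph D k n) u v \<longrightarrow>
        (\<exists>x\<in>verts (parent_tree par n). u \<in> reach D k x \<and> v \<in> reach D k x)"
      by (metis adj_reach_graph atMost_iff self_in_reach verts_parent_tree)
    show "\<forall>v\<in>verts (reach_graph D k n). \<exists>x\<in>verts (parent_tree par n). v \<in> reach D k x"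
      using self_in_reach by fastforce
  qed (use conn is_tree_parent_tree[OF par] in auto)
  moreover have "card (reach D k x) \<le> ((k + t choose t) - 1) + 1" for x
    using card_reach[OF assms] by (simp add: Suc_leI)
  ultimately show ?thesis unfolding treewidth_le_def by blast
qed

lemma reach_along:
  assumes "z \<in> reach D r (w 0)"
    and "\<And>i. i < n \<Longrightarrow> w i = w (Suc i) \<or> w i \<in> D (w (Suc i)) \<or> w (Suc i) \<in> D (w i)"
    and "\<And>i. i \<le> n \<Longrightarrow> z \<le> w i"
  shows "z \<in> reach D (r + n) (w n)"
  using assms
proof (induction n)
  case (Suc n)
  then have "z \<in> reach D (r + n) (w n)" by simp
  then show ?case using Suc.prems(2)[of n] Suc.prems(3)[of "Suc n"] reach_edge by auto
qed simp

end

section \<open>Placing the vertices of the shortcut graph\<close>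

lemma in_internal_verts_iff:
  "u \<in> internal_verts W \<longleftrightarrow> (\<exists>j. 0 < j \<and> j + 1 < length W \<and> u = W ! j)"
proof
  assume "u \<in> internal_verts W"
  then obtain i where i: "i < length (butlast (tl W))" "u = butlast (tl W) ! i"
    by (auto simp: internal_verts_def in_set_conv_nth)
  then show "\<exists>j. 0 < j \<and> j + 1 < length W \<and> u = W ! j"
    by (intro exI[of _ "Suc i"]) (auto simp: nth_butlast nth_tl)
next
  assume "\<exists>j. 0 < j \<and> j + 1 < length W \<and> u = W ! j"
  then obtain j where j: "0 < j" "j + 1 < length W" "u = W ! j" by blast
  then have "u = butlast (tl W) ! (j - 1)" "j - 1 < length (butlast (tl W))"
    by (auto simp: nth_butlast nth_tl)
  then show "u \<in> internal_verts W" by (auto simp: internal_verts_def)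
qed

lemma is_walk_rev:
  assumes "wf_graph G" "is_walk G W"
  shows "is_walk G (rev W)"
  unfolding is_walk_def
proof (intro conjI allI impI)
  fix i assume i: "i + 1 < length (rev W)"
  define j where "j = length W - Suc (Suc i)"
  have "adj G (W ! j) (W ! (j + 1))" using assms(2) i by (simp add: is_walk_def j_def)
  then have "adj G (W ! (j + 1)) (W ! j)" using assms(1) wf_graph_adjD(3) by metis
  moreover have "rev W ! i = W ! (j + 1)" "rev W ! (i + 1) = W ! j"
    using i by (auto simp: rev_nth j_def Suc_diff_Suc)
  ultimately show "adj G (rev W ! i) (rev W ! (i + 1))" by simp
qed (use assms in \<open>auto simp: is_walk_def\<close>)

lemma internal_verts_rev [simp]: "internal_verts (rev W) = internal_verts W"
proof -
  have "tl (rev W) = rev (butlast W)" by (cases W rule: rev_cases) auto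
  then show ?thesis by (simp add: internal_verts_def butlast_tl)
qed

text \<open>An embedding of \<open>G\<close> into the product, reduced to numbers:
  \<open>g v\<close> is the node and \<open>p v\<close> the layer, while \<open>card_cell\<close>
  records the complete factor.\<close>

locale shortcut_placement = elimination_order +
  fixes G :: "'g graph" and k d l :: nat and PS :: "'g list set" and g p :: "'g \<Rightarrow> nat"
  assumes wf: "wf_graph G" and shortcuts: "shortcut_system G k d PS"
    and pos: "0 < k" "0 < d"
    and g_adj: "adj G u v \<Longrightarrow> g u = g v \<or> g u \<in> D (g v) \<or> g v \<in> D (g u)"
    and p_adj: "adj G u v \<Longrightarrow> p u \<le> p v + 1"
    and card_cell: "card {v \<in> verts G. g v = y \<and> p v = i} \<le> l"
begin

lemma finite_verts: "finite (verts G)"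
  using wf by (simp add: wf_graph_def)

lemma shortcutD:
  assumes "W \<in> PS"
  shows "is_walk G W" "distinct W" "2 \<le> length W" "length W \<le> k + 1" "set W \<subseteq> verts G"
  using assms shortcuts by (auto simp: shortcut_system_def is_path_in_def is_walk_def)

lemma finite_PS: "finite PS"
proof (rule finite_subset)
  show "PS \<subseteq> {xs. set xs \<subseteq> verts G \<and> distinct xs}" using shortcutD(2,5) by blast
qed (rule finite_subset_distinct[OF finite_verts])

text \<open>Including \<open>g v\<close> keeps the set non-empty. All vertices of a shortcut see its
  internal vertices, so \<open>place\<close> of either endpoint is at most \<open>g u\<close> for
  each internal \<open>u\<close>.\<close>

definition candidates :: "'g \<Rightarrow> nat set" where
  "candidates v = insert (g v) {g u |u W. W \<in> PS \<and> v \<in> set W \<and> u \<in> internal_verts W}"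

definition place :: "'g \<Rightarrow> nat" where
  "place v = Min (candidates v)"

lemma internal_verts_subset: "W \<in> PS \<Longrightarrow> internal_verts W \<subseteq> verts G"
  using shortcutD(5) by (force simp: in_internal_verts_iff)

lemma finite_candidates: "finite (candidates v)"
proof -
  have "candidates v \<subseteq> insert (g v) (g ` verts G)"
    using internal_verts_subset by (auto simp: candidates_def)
  then show ?thesis using finite_verts finite_subset by blast
qed

lemma place_le: "place v \<le> g v"
  unfolding place_def by (rule Min_le) (simp_all add: finite_candidates, simp add: candidates_def)

lemma place_le_internal:
  assumes "W \<in> PS" "v \<in> set W" "u \<in> internal_verts W"
  shows "place v \<le> g u"
  unfolding place_def
  by (rule Min_le) (use assms in \<open>auto simp: finite_candidates, auto simp: candidates_def\<close>)

lemma place_cases: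
  obtains "place v = g v"
  | u W where "W \<in> PS" "v \<in> set W" "u \<in> internal_verts W" "place v = g u"
proof -
  have "place v \<in> candidates v"
    unfolding place_def by (rule Min_in) (auto simp: finite_candidates, auto simp: candidates_def)
  then show thesis using that by (auto simp: candidates_def)
qed

lemma reach_on_walk:
  assumes W: "is_walk G W" and ij: "i < length W" "j < length W"
    and start: "z \<in> reach D r (g (W ! i))"
    and above: "\<And>m. min i j \<le> m \<Longrightarrow> m \<le> max i j \<Longrightarrow> z \<le> g (W ! m)"
  shows "z \<in> reach D (r + (max i j - min i j)) (g (W ! j))"
proof (cases "i \<le> j")
  case True
  have "z \<in> reach D (r + (j - i)) (g (W ! (i + (j - i))))"
  proof (rule reach_along[where w = "\<lambda>m. g (W ! (i + m))"])
    fix m assume m: "m < j - i"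
    then have "adj G (W ! (i + m)) (W ! (i + Suc m))"
      using W ij by (auto simp: is_walk_def)
    then show "g (W ! (i + m)) = g (W ! (i + Suc m)) \<or> g (W ! (i + m)) \<in> D (g (W ! (i + Suc m)))
        \<or> g (W ! (i + Suc m)) \<in> D (g (W ! (i + m)))" by (rule g_adj)
  qed (use start above True in auto)
  then show ?thesis using True by (simp add: min_def max_def)
next
  case False
  have "z \<in> reach D (r + (i - j)) (g (W ! (i - (i - j))))"
  proof (rule reach_along[where w = "\<lambda>m. g (W ! (i - m))"])
    fix m assume m: "m < i - j"
    then have "adj G (W ! (i - Suc m)) (W ! (i - Suc m + 1))"
      using W ij by (auto simp: is_walk_def)
    then have "adj G (W ! (i - Suc m)) (W ! (i - m))" using m by (simp add: Suc_diff_Suc)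
    then show "g (W ! (i - m)) = g (W ! (i - Suc m)) \<or> g (W ! (i - m)) \<in> D (g (W ! (i - Suc m)))
        \<or> g (W ! (i - Suc m)) \<in> D (g (W ! (i - m)))"
      using g_adj by metis
  qed (use start above False in auto)
  then show ?thesis using False by (simp add: min_def max_def)
qed

text \<open>The shortcut that defines \<open>place v\<close> is followed from \<open>u\<close> to
  \<open>v\<close>. All vertices on the way, apart from possibly \<open>v\<close>, are internal to
  it, so none lies below \<open>place v\<close>.\<close>

lemma place_in_reach: "place v \<in> reach D (k - 1) (g v)"
proof (cases v rule: place_cases)
  case (2 u W)
  obtain i where i: "i < length W" "W ! i = v" using 2(2) by (auto simp: in_set_conv_nth)
  obtain j where j: "0 < j" "j + 1 < length W" "u = W ! j"
    using 2(3) by (auto simp: in_internal_verts_iff)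
  have "place v \<in> reach D (0 + (max j i - min j i)) (g (W ! i))"
  proof (rule reach_on_walk[OF shortcutD(1)[OF 2(1)]])
    fix m assume m: "min j i \<le> m" "m \<le> max j i"
    show "place v \<le> g (W ! m)"
    proof (cases "m = i")
      case False
      then have "0 < m" "m + 1 < length W" using m i j by auto
      then have "W ! m \<in> internal_verts W" by (auto simp: in_internal_verts_iff)
      then show ?thesis using place_le_internal 2 by blast
    qed (use i place_le in simp)
  qed (use i j 2 in auto)
  \<comment> \<open>The internal index \<open>j\<close> misses both ends of a path with at most
    \<open>k\<close> edges, which saves one step.\<close>
  moreover have "max j i - min j i \<le> k - 1"
    using i j shortcutD(4)[OF 2(1)] by (auto simp: max_def min_def)
  ultimately show ?thesis using i reach_mono by (metis add_0 subsetD)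
qed simp

text \<open>The walk shows that \<open>place w\<close> is reachable, in any number of steps, from
  \<open>g v\<close> or from its neighbour on the walk. Skipping then keeps only the at most
  \<open>k - 1\<close> steps from \<open>g v\<close> to \<open>place v\<close>, plus one if
  \<open>g v\<close> lies below \<open>place w\<close>.\<close>

lemma place_endpoints_ordered:
  assumes W: "is_walk G W" "2 \<le> length W"
    and int: "\<And>u. u \<in> internal_verts W \<Longrightarrow> place (last W) \<le> g u"
    and le: "place (hd W) \<le> place (last W)"
  shows "place (hd W) \<in> reach D k (place (last W))"
proof -
  define v w n where "v = hd W" and "w = last W" and "n = length W - 1"
  have ne: "W \<noteq> []" using W by auto
  have W0: "W ! 0 = v" and Wn: "W ! n = w" and n: "1 \<le> n" "n < length W"
    using W ne by (auto simp: v_def w_def n_def hd_conv_nth last_conv_nth)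
  have w: "place w \<in> reach D (k - 1) (g (W ! n))" using place_in_reach Wn by simp
  have inner: "place w \<le> g (W ! m)" if "0 < m" "m \<le> n" for m
  proof (cases "m = n")
    case False
    then have "W ! m \<in> internal_verts W" using that by (auto simp: in_internal_verts_iff n_def)
    then show ?thesis using int by (simp add: w_def)
  qed (use Wn place_le in simp)
  show ?thesis
  proof (cases "place w \<le> g v")
    case True
    have all: "place w \<le> g (W ! m)" if "m \<le> n" for m
      using that inner W0 True by (cases "m = 0") auto
    have "place w \<in> reach D (k - 1 + (max n 0 - min n 0)) (g (W ! 0))"
      by (rule reach_on_walk[OF W(1) n(2) _ w]) (use all ne in auto)
    then have "place v \<in> reach D (k - 1) (place w)"
      using le unfolding W0 v_def[symmetric] w_def[symmetric]
      by (rule reach_skip[OF _ place_in_reach])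
    then show ?thesis using reach_mono[of "k - 1" k] by (auto simp: v_def w_def)
  next
    case False
    \<comment> \<open>Only the endpoint \<open>v\<close> lies below \<open>place w\<close>, so \<open>g v\<close> is a single step away from it.\<close>
    have "place w \<in> reach D (k - 1 + (max n 1 - min n 1)) (g (W ! 1))"
      by (rule reach_on_walk[OF W(1) n(2) _ w]) (use inner n in auto)
    \<comment> \<open>Otherwise \<open>g (W ! 1) \<le> g v < place w\<close>, against
      \<open>inner\<close>.\<close>
    moreover have "g v \<in> D (g (W ! 1))"
    proof -
      have "adj G (W ! 0) (W ! (0 + 1))" using W unfolding is_walk_def by fastforce
      then have "g v = g (W ! 1) \<or> g v \<in> D (g (W ! 1)) \<or> g (W ! 1) \<in> D (g v)"
        using g_adj W0 by simp
      then show ?thesis using False inner[of 1] n D_less[of "g (W ! 1)" "g v"] by auto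
    qed
    ultimately have "g v \<in> D (place w)" using below_in_D False by (meson not_le)
    then have "place v \<in> reach D (Suc (k - 1)) (place w)" using place_in_reach[of v] by auto
    then show ?thesis using pos by (simp add: v_def w_def)
  qed
qed

lemma place_endpoints:
  assumes W: "is_walk G W" "2 \<le> length W"
    and int: "\<And>u. u \<in> internal_verts W \<Longrightarrow> place (hd W) \<le> g u \<and> place (last W) \<le> g u"
  shows "place (hd W) \<in> reach D k (place (last W)) \<or> place (last W) \<in> reach D k (place (hd W))"
proof (cases "place (hd W) \<le> place (last W)")
  case True
  then show ?thesis using place_endpoints_ordered[OF W] int by blast
next
  case False
  then show ?thesis
    using place_endpoints_ordered[OF is_walk_rev[OF wf W(1)]] W int
    by (auto simp: hd_rev last_rev)
qed

text \<open>An edge of \<open>G\<close> is treated as a shortcut of length one without internal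
  vertices, so that both kinds of edges are handled alike.\<close>

lemma shortcut_adj_cases:
  assumes "adj (shortcut_graph G PS) u v"
  obtains W where "is_walk G W" "2 \<le> length W" "length W \<le> k + 1" "distinct W"
    "{u, v} = {hd W, last W}"
    "\<And>x. x \<in> internal_verts W \<Longrightarrow> place (hd W) \<le> g x \<and> place (last W) \<le> g x"
proof -
  have "adj G u v \<or> (\<exists>W\<in>PS. {u, v} = {hd W, last W})"
    using assms by (auto simp: shortcut_graph_def adj_def)
  then show thesis
  proof
    assume uv: "adj G u v"
    show thesis
    proof (rule that[of "[u, v]"])
      show "is_walk G [u, v]" using wf_graph_adjD[OF wf uv] uv
        by (simp add: is_walk_Cons_Cons) (simp add: is_walk_def)
    qed (use pos wf_graph_adjD[OF wf uv] in \<open>auto simp: internal_verts_def\<close>)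
  next
    assume "\<exists>W\<in>PS. {u, v} = {hd W, last W}"
    then obtain W where W: "W \<in> PS" "{u, v} = {hd W, last W}" by blast
    moreover have "W \<noteq> []" using shortcutD(3)[OF W(1)] by auto
    ultimately show thesis using that[of W] shortcutD[OF W(1)] place_le_internal[OF W(1)] by simp
  qed
qed

lemma layer_on_walk:
  assumes W: "is_walk G W" and ij: "i < length W" "j < length W"
  shows "p (W ! i) \<le> p (W ! j) + (length W - 1)"
proof -
  have fwd: "p (W ! a) \<le> p (W ! (a + m)) + m \<and> p (W ! (a + m)) \<le> p (W ! a) + m"
    if "a + m < length W" for a m
    using that
  proof (induction m)
    case (Suc m)
    then have "adj G (W ! (a + m)) (W ! (a + Suc m))" using W by (simp add: is_walk_def)
    then have "p (W ! (a + m)) \<le> p (W ! (a + Suc m)) + 1" "p (W ! (a + Suc m)) \<le> p (W ! (a + m)) + 1"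
      using p_adj wf_graph_adjD(3)[OF wf] by blast+
    then show ?case using Suc by simp
  qed simp
  show ?thesis
  proof (cases "i \<le> j")
    case True
    then have "p (W ! i) \<le> p (W ! j) + (j - i)" using fwd[of i "j - i"] ij by simp
    then show ?thesis using ij by linarith
  next
    case False
    then have "p (W ! i) \<le> p (W ! j) + (i - j)" using fwd[of j "i - j"] ij by simp
    then show ?thesis using ij by linarith
  qed
qed

lemma shortcut_adj:
  assumes "adj (shortcut_graph G PS) u v"
  shows "u \<noteq> v" "u \<in> verts G" "v \<in> verts G"
    "place u \<in> reach D k (place v) \<or> place v \<in> reach D k (place u)" "p u \<le> p v + k"
proof -
  obtain W where W: "is_walk G W" "2 \<le> length W" "length W \<le> k + 1" "distinct W"
    "{u, v} = {hd W, last W}"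
    "\<And>x. x \<in> internal_verts W \<Longrightarrow> place (hd W) \<le> g x \<and> place (last W) \<le> g x"
    using shortcut_adj_cases[OF assms] by metis
  have ne: "W \<noteq> []" using W(2) by auto
  let ?n = "length W - 1"
  have ends: "hd W = W ! 0" "last W = W ! ?n" "?n < length W" "0 < ?n"
    using ne W(2) by (auto simp: hd_conv_nth last_conv_nth)
  have "hd W \<noteq> last W" using nth_eq_iff_index_eq[OF W(4), of 0 ?n] ends ne by (metis length_greater_0_conv less_irrefl)
  then show "u \<noteq> v" using W(5) by (metis doubleton_eq_iff insert_absorb2)
  have "hd W \<in> verts G" "last W \<in> verts G" using W(1) ne by (auto simp: is_walk_def)
  then show "u \<in> verts G" "v \<in> verts G" using W(5) by (metis doubleton_eq_iff)+
  show "place u \<in> reach D k (place v) \<or> place v \<in> reach D k (place u)"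
    using place_endpoints[OF W(1,2,6)] W(5) by (metis doubleton_eq_iff)
  have "p (hd W) \<le> p (last W) + k" "p (last W) \<le> p (hd W) + k"
    using layer_on_walk[OF W(1), of 0 ?n] layer_on_walk[OF W(1), of ?n 0] ends W(3)
    by fastforce+
  then show "p u \<le> p v + k" using W(5) by (metis doubleton_eq_iff)
qed

section \<open>Counting the vertices that share a place and a merged layer\<close>

lemma card_strip:
  assumes "finite I"
  shows "card {v \<in> verts G. g v = y \<and> p v \<in> I} \<le> card I * l"
proof -
  have "{v \<in> verts G. g v = y \<and> p v \<in> I} = (\<Union>i\<in>I. {v \<in> verts G. g v = y \<and> p v = i})" by auto
  also have "card \<dots> \<le> (\<Sum>i\<in>I. card {v \<in> verts G. g v = y \<and> p v = i})"
    by (rule card_UN_le[OF assms])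
  also have "\<dots> \<le> (\<Sum>i\<in>I. l)" by (rule sum_mono) (rule card_cell)
  finally show ?thesis by simp
qed

lemma card_place_fibre:
  "card {v \<in> verts G. place v = y \<and> p v div k = j} \<le> d * l * (k ^ 3 + 3 * k)"
proof -
  define S1 where "S1 = {v \<in> verts G. g v = y \<and> p v \<in> {j * k..<j * k + k}}"
  \<comment> \<open>An internal vertex \<open>u\<close> of a shortcut through \<open>v\<close> is at
    most \<open>k\<close> layers from \<open>v\<close>, which leaves \<open>3 * k\<close> layers;
    truncation at \<open>0\<close> only shortens this range.\<close>
  define U where "U = {u \<in> verts G. g u = y \<and> p u \<in> {j * k - k..<j * k + 2 * k}}"
  \<comment> \<open>A moved \<open>v\<close> lies on a shortcut through some \<open>u\<close> with
    \<open>g u = y\<close>, and \<open>v\<close> differs from \<open>u\<close> as \<open>g v\<close>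
    is not \<open>y\<close>. Removing \<open>u\<close> leaves at most \<open>k\<close> vertices per
    shortcut.\<close>
  define S2 where "S2 = (\<Union>u\<in>U. \<Union>W\<in>{W \<in> PS. u \<in> internal_verts W}. set W - {u})"
  have finU: "finite U" using finite_verts by (simp add: U_def)
  have "{v \<in> verts G. place v = y \<and> p v div k = j} \<subseteq> S1 \<union> S2"
  proof
    fix v assume "v \<in> {v \<in> verts G. place v = y \<and> p v div k = j}"
    then have v: "v \<in> verts G" "place v = y" "p v div k = j" by auto
    have pv: "j * k \<le> p v" "p v < j * k + k"
      using v(3) dividend_less_div_times[OF pos(1), of "p v"] by (auto simp: add.commute)
    show "v \<in> S1 \<union> S2"
    proof (cases "g v = y")
      case False
      then obtain u W where uW: "W \<in> PS" "v \<in> set W" "u \<in> internal_verts W" "y = g u"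
        using place_cases[of v] v(2) by metis
      have "u \<in> set W" using uW by (auto simp: in_internal_verts_iff)
      moreover from this have "u \<in> verts G" using shortcutD(5)[OF uW(1)] by blast
      ultimately have u: "u \<in> set W" "u \<in> verts G" .
      obtain a b where "a < length W" "W ! a = u" "b < length W" "W ! b = v"
        using u uW by (auto simp: in_set_conv_nth)
      then have "p u \<le> p v + k" "p v \<le> p u + k"
        using layer_on_walk[OF shortcutD(1)[OF uW(1)]] shortcutD(4)[OF uW(1)] by fastforce+
      then have "u \<in> U" using u uW pv by (auto simp: U_def)
      moreover have "v \<noteq> u" using False uW by auto
      ultimately show ?thesis using uW by (auto simp: S2_def)
    qed (use v pv in \<open>auto simp: S1_def\<close>)
  qed
  moreover have "finite (S1 \<union> S2)"
    using finite_verts finU finite_PS by (auto simp: S1_def S2_def)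
  ultimately have "card {v \<in> verts G. place v = y \<and> p v div k = j} \<le> card S1 + card S2"
    by (meson card_Un_le card_mono le_trans)
  also have "card S1 \<le> k * l" using card_strip[of "{j * k..<j * k + k}" y] by (simp add: S1_def)
  also have "card S2 \<le> 3 * k * l * (d * k)"
  proof -
    have "card S2 \<le> (\<Sum>u\<in>U. card (\<Union>W\<in>{W \<in> PS. u \<in> internal_verts W}. set W - {u}))"
      unfolding S2_def by (rule card_UN_le[OF finU])
    also have "\<dots> \<le> (\<Sum>u\<in>U. d * k)"
    proof (rule sum_mono)
      fix u assume "u \<in> U"
      then have uG: "u \<in> verts G" by (simp add: U_def)
      let ?Q = "{W \<in> PS. u \<in> internal_verts W}"
      have "card (set W - {u}) \<le> k" if "W \<in> ?Q" for W
      proof -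
        have "u \<in> set W" using that by (auto simp: in_internal_verts_iff)
        then have "card (set W - {u}) = length W - 1"
          using shortcutD(2)[of W] that by (simp add: distinct_card)
        then show ?thesis using shortcutD(4)[of W] that by simp
      qed
      then have "card (\<Union>W\<in>?Q. set W - {u}) \<le> card ?Q * k"
        using card_UN_le[of ?Q "\<lambda>W. set W - {u}"] finite_PS
          sum_bounded_above[of ?Q "\<lambda>W. card (set W - {u})" k] by fastforce
      also have "\<dots> \<le> d * k" using shortcuts uG by (simp add: shortcut_system_def)
      finally show "card (\<Union>W\<in>?Q. set W - {u}) \<le> d * k" .
    qed
    also have "\<dots> = card U * (d * k)" by simp
    also have "card U \<le> card {j * k - k..<j * k + 2 * k} * l"
      unfolding U_def by (rule card_strip) simp
    also have "card {j * k - k..<j * k + 2 * k} \<le> 3 * k" by simp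
    finally show ?thesis by simp
  qed
  also have "k * l + 3 * k * l * (d * k) \<le> d * l * (k ^ 3 + 3 * k)"
  proof -
    \<comment> \<open>Equality holds at \<open>k = 1\<close> and \<open>k = 2\<close>; from 3 on,
      the cubic term alone dominates \<open>3 * k * k\<close>.\<close>
    have "3 * k * k + k \<le> k ^ 3 + 3 * k"
    proof (cases "k \<le> 2")
      case True
      then consider "k = 1" | "k = 2" using pos by linarith
      then show ?thesis by cases auto
    next
      case False
      then have "3 * (k * k) \<le> k * (k * k)" by (intro mult_right_mono) auto
      then have "3 * k * k \<le> k ^ 3" by (simp only: power3_eq_cube mult.assoc)
      then show ?thesis by simp
    qed
    then have "d * l * (3 * k * k + k) \<le> d * l * (k ^ 3 + 3 * k)" by (rule mult_left_mono) simp
    moreover have "k * l \<le> d * l * k" using pos by simp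
    moreover have "d * l * (3 * k * k + k) = d * l * k + 3 * k * l * (d * k)"
      by (simp add: algebra_simps)
    ultimately show ?thesis by linarith
  qed
  finally show ?thesis by simp
qed

end

section \<open>The embedding\<close>

text \<open>Supplies the coordinate in the complete graph: labels from \<open>M\<close> values that
  separate vertices with equal remaining coordinates.\<close>

lemma fibrewise_numbering:
  assumes "finite V" "\<And>x. card {v \<in> V. f v = x} \<le> M"
  obtains c :: "'a \<Rightarrow> nat" where "\<And>v. v \<in> V \<Longrightarrow> c v < M" "inj_on (\<lambda>v. (f v, c v)) V"
proof -
  have "\<exists>e. inj_on e {v \<in> V. f v = x} \<and> e ` {v \<in> V. f v = x} \<subseteq> {..<M}" for x
    using assms inj_on_iff_card_le[of "{v \<in> V. f v = x}" "{..<M}"] by simp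
  then obtain e where e: "\<And>x. inj_on (e x) {v \<in> V. f v = x}" "\<And>x. e x ` {v \<in> V. f v = x} \<subseteq> {..<M}"
    by metis
  show thesis
  proof (rule that[of "\<lambda>v. e (f v) v"])
    show "inj_on (\<lambda>v. (f v, e (f v) v)) V"
      using e(1) by (fastforce simp: inj_on_def)
  qed (use e(2) in blast)
qed

lemma verts_strong_prod [simp]: "verts (strong_prod A B) = verts A \<times> verts B"
  and adj_strong_prod: "adj (strong_prod A B) (v, x) (w, y) \<longleftrightarrow>
    v \<in> verts A \<and> w \<in> verts A \<and> x \<in> verts B \<and> y \<in> verts B \<and> (v, x) \<noteq> (w, y) \<and>
    (v = w \<and> adj B x y \<or> x = y \<and> adj A v w \<or> adj A v w \<and> adj B x y)"
  by (auto simp: strong_prod_def verts_def adj_def)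

lemma verts_complete_graph [simp]: "verts (complete_graph m) = {0..<m}"
  and adj_complete_graph: "adj (complete_graph m) i j \<longleftrightarrow> i < m \<and> j < m \<and> i \<noteq> j"
  by (auto simp: complete_graph_def verts_def adj_def)

definition line_graph :: "nat \<Rightarrow> nat graph" where
  "line_graph n = ({..n}, {(i, j). i \<le> n \<and> j \<le> n \<and> (j = Suc i \<or> i = Suc j)})"

lemma verts_line_graph [simp]: "verts (line_graph n) = {..n}"
  and adj_line_graph: "adj (line_graph n) i j \<longleftrightarrow> i \<le> n \<and> j \<le> n \<and> (j = Suc i \<or> i = Suc j)"
  by (auto simp: line_graph_def verts_def adj_def)

lemma is_path_graph_line_graph: "is_path_graph (line_graph n)"
proof -
  have "wf_graph (line_graph n)"
    unfolding wf_graph_def by (auto simp: adj_line_graph) (auto simp: line_graph_def)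
  moreover have "adj (line_graph n) u v \<longleftrightarrow> (\<exists>i. i + 1 < length [0..<Suc n] \<and>
      ((u = [0..<Suc n] ! i \<and> v = [0..<Suc n] ! (i + 1)) \<or>
       (v = [0..<Suc n] ! i \<and> u = [0..<Suc n] ! (i + 1))))"
    (is "_ \<longleftrightarrow> (\<exists>i. ?edge i)") for u v
  proof
    assume "adj (line_graph n) u v"
    then have "?edge (min u v)" by (auto simp: adj_line_graph simp del: upt_Suc)
    then show "\<exists>i. ?edge i" ..
  qed (auto simp: adj_line_graph simp del: upt_Suc)
  ultimately show ?thesis
    unfolding is_path_graph_def
    by (intro conjI exI[of _ "[0..<Suc n]"]) (auto simp del: upt_Suc)
qed

lemma path_graph_numbering:
  assumes "is_path_graph P"
  obtains q :: "'p \<Rightarrow> nat" where "inj_on q (verts P)" "\<And>x y. adj P x y \<Longrightarrow> q x \<le> q y + 1"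
proof -
  obtain xs where xs: "distinct xs" "set xs = verts P"
    and P: "\<And>u v. adj P u v \<Longrightarrow> \<exists>i. i + 1 < length xs \<and>
        ((u = xs ! i \<and> v = xs ! (i + 1)) \<or> (v = xs ! i \<and> u = xs ! (i + 1)))"
    using assms unfolding is_path_graph_def by metis
  have bij: "bij_betw ((!) xs) {..<length xs} (verts P)"
    using xs by (simp add: bij_betw_nth)
  define q where "q = inv_into {..<length xs} ((!) xs)"
  have q: "q (xs ! i) = i" if "i < length xs" for i
    using that bij by (simp add: q_def bij_betw_def inv_into_f_f)
  show thesis
  proof (rule that[of q])
    show "inj_on q (verts P)" using bij_betw_inv_into[OF bij] by (simp add: q_def bij_betw_def)
    show "q x \<le> q y + 1" if "adj P x y" for x y using P[OF that] q by auto
  qed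
qed

text \<open>In the complete factor any two labels are equal or adjacent, so edges constrain only
  \<open>a\<close> and \<open>q\<close>; injectivity excludes that all three coordinates
  agree.\<close>

lemma subgraph_of_strong_prodI:
  assumes inj: "inj_on (\<lambda>v. ((a v, q v), c v)) (verts G)"
    and range: "\<And>v. v \<in> verts G \<Longrightarrow> a v \<in> verts J \<and> q v \<in> verts P \<and> c v < M"
    and adj: "\<And>u v. adj G u v \<Longrightarrow> u \<in> verts G \<and> v \<in> verts G \<and> u \<noteq> v
      \<and> (a u = a v \<or> adj J (a u) (a v)) \<and> (q u = q v \<or> adj P (q u) (q v))"
  shows "subgraph_of G (strong_prod (strong_prod J P) (complete_graph M))"
  unfolding subgraph_of_def
proof (intro exI conjI allI impI)
  fix u v assume uv: "adj G u v"
  then have "((a u, q u), c u) \<noteq> ((a v, q v), c v)" using adj[OF uv] inj by (auto dest: inj_onD)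
  then show "Defs.adj (strong_prod (strong_prod J P) (complete_graph M))
      ((a u, q u), c u) ((a v, q v), c v)"
    using adj[OF uv] range[of u] range[of v]
    by (auto simp: adj_strong_prod adj_complete_graph)
qed (use inj range in auto)

lemma div_le_Suc_div:
  fixes k :: nat
  assumes "x \<le> y + k"
  shows "x div k \<le> Suc (y div k)"
proof (cases "k = 0")
  case False
  have "x div k \<le> (y + k) div k" using assms by (rule div_le_mono)
  then show ?thesis using False by (simp add: div_add_self2)
qed simp

theorem theorem4:
  fixes t l k d :: nat
    and G :: "'g graph" and H :: "'h graph" and P :: "'p graph" and PS :: "'g list set"
  assumes "t > 0" "l > 0" "k > 0" "d > 0"
    and "wf_graph G" "wf_graph H"
    and "treewidth_le H t"
    and "is_path_graph P"
    and "subgraph_of G (strong_prod (strong_prod H P) (complete_graph l))"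
    and "shortcut_system G k d PS"
  shows "\<exists>(J :: nat graph) (P' :: nat graph). wf_graph J \<and> treewidth_le J ((k + t choose t) - 1)
           \<and> is_path_graph P'
           \<and> subgraph_of (shortcut_graph G PS)
               (strong_prod (strong_prod J P') (complete_graph (d * l * (k ^ 3 + 3 * k))))"
proof -
  obtain f :: "'h \<Rightarrow> nat" and D n where f: "inj_on f (verts H)" "f ` verts H \<subseteq> {..<n}"
    and D: "elimination_order D" "\<And>x. card (D x) \<le> t"
    and f_adj: "\<And>u v. adj H u v \<Longrightarrow> f u \<in> D (f v) \<or> f v \<in> D (f u)"
    using treewidth_le_elimination_order[OF assms(6,7)] by metis
  obtain idx :: "'p \<Rightarrow> nat" where idx: "inj_on idx (verts P)"
    and idx_adj: "\<And>x y. adj P x y \<Longrightarrow> idx x \<le> idx y + 1"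
    using path_graph_numbering[OF assms(8)] by metis
  obtain \<phi> where \<phi>: "inj_on \<phi> (verts G)"
    "\<phi> ` verts G \<subseteq> verts (strong_prod (strong_prod H P) (complete_graph l))"
    and \<phi>_adj: "\<And>u v. adj G u v \<Longrightarrow>
      adj (strong_prod (strong_prod H P) (complete_graph l)) (\<phi> u) (\<phi> v)"
    using assms(9) unfolding subgraph_of_def by blast
  define h pp c where "h v = fst (fst (\<phi> v))" and "pp v = snd (fst (\<phi> v))" and "c v = snd (\<phi> v)" for v
  have \<phi>_eq: "\<phi> v = ((h v, pp v), c v)" for v by (simp add: h_def pp_def c_def)
  have range: "h v \<in> verts H" "pp v \<in> verts P" "c v < l" if "v \<in> verts G" for v
    using that \<phi>(2) \<phi>_eq[of v] by (auto simp: image_subset_iff)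
  have h_adj: "h u = h v \<or> adj H (h u) (h v)" and pp_adj: "pp u = pp v \<or> adj P (pp u) (pp v)"
    if "adj G u v" for u v
    using \<phi>_adj[OF that] by (auto simp: \<phi>_eq adj_strong_prod)
  define g p where "g v = f (h v)" and "p v = idx (pp v)" for v
  interpret shortcut_placement D G k d l PS g p
  proof (intro shortcut_placement.intro shortcut_placement_axioms.intro)
    show "card {v \<in> verts G. g v = y \<and> p v = i} \<le> l" for y i
    proof -
      \<comment> \<open>Within a cell, injectivity of \<open>f\<close> and \<open>idx\<close> fixes
        the first two coordinates of \<open>\<phi>\<close>, so the label in the complete graph
        determines the vertex.\<close>
      have "inj_on c {v \<in> verts G. g v = y \<and> p v = i}"
      proof (rule inj_onI)
        fix u v assume u: "u \<in> {v \<in> verts G. g v = y \<and> p v = i}"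
          and v: "v \<in> {v \<in> verts G. g v = y \<and> p v = i}" and "c u = c v"
        have "h u = h v" "pp u = pp v"
          using u v range f(1) idx by (auto simp: g_def p_def dest: inj_onD)
        then show "u = v" using u v \<open>c u = c v\<close> inj_onD[OF \<phi>(1)] \<phi>_eq[of u] \<phi>_eq[of v] by simp
      qed
      then show ?thesis
        using card_inj_on_le[of c _ "{..<l}"] range(3) by fastforce
    qed
    show "g u = g v \<or> g u \<in> D (g v) \<or> g v \<in> D (g u)" if "adj G u v" for u v
      using h_adj[OF that] f_adj by (auto simp: g_def)
    show "p u \<le> p v + 1" if "adj G u v" for u v
      using pp_adj[OF that] idx_adj by (auto simp: p_def)
  qed (use assms D in auto)
  define M where "M = d * l * (k ^ 3 + 3 * k)"
  \<comment> \<open>A bound for the original layers, hence for the merged ones; the inserted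
    \<open>0\<close> makes the maximum well defined at once.\<close>
  define N where "N = Max (insert 0 (p ` verts G))"
  let ?J = "reach_graph D k n" and ?P' = "line_graph N"
  have fibre: "card {v \<in> verts G. (place v, p v div k) = x} \<le> M" for x
    using card_place_fibre[of "fst x" "snd x"] by (simp add: M_def prod_eq_iff)
  obtain c' where c': "\<And>v. v \<in> verts G \<Longrightarrow> c' v < M"
    "inj_on (\<lambda>v. ((place v, p v div k), c' v)) (verts G)"
    using fibrewise_numbering[OF finite_verts fibre] by blast
  have verts_sc: "verts (shortcut_graph G PS) = verts G" by (simp add: shortcut_graph_def verts_def)
  have place_range: "place v \<le> n" if "v \<in> verts G" for v
    using place_le[of v] range(1)[OF that] f(2) by (fastforce simp: g_def)
  have layer_range: "p v div k \<le> N" if "v \<in> verts G" for v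
  proof -
    have "p v \<le> N" using that finite_verts by (simp add: N_def)
    then show ?thesis using div_le_dividend le_trans by blast
  qed
  have "subgraph_of (shortcut_graph G PS) (strong_prod (strong_prod ?J ?P') (complete_graph M))"
  proof (rule subgraph_of_strong_prodI)
    fix u v assume uv: "adj (shortcut_graph G PS) u v"
    \<comment> \<open>The layer bound of \<open>shortcut_adj\<close> is one-sided, so it is applied
      in both directions.\<close>
    then have vu: "adj (shortcut_graph G PS) v u"
      using wf_graph_adjD(3)[OF wf] by (auto simp: shortcut_graph_def adj_def)
    note * = shortcut_adj[OF uv]
    have "p u div k \<le> Suc (p v div k)" "p v div k \<le> Suc (p u div k)"
      using shortcut_adj(5)[OF uv] shortcut_adj(5)[OF vu] by (auto intro: div_le_Suc_div)
    then have "p u div k = p v div k \<or> adj ?P' (p u div k) (p v div k)"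
      using layer_range *(2,3) by (auto simp: adj_line_graph)
    moreover have "place u = place v \<or> adj ?J (place u) (place v)"
      using * place_range by (auto simp: adj_reach_graph)
    ultimately show "u \<in> verts (shortcut_graph G PS) \<and> v \<in> verts (shortcut_graph G PS) \<and> u \<noteq> v
        \<and> (place u = place v \<or> adj ?J (place u) (place v))
        \<and> (p u div k = p v div k \<or> adj ?P' (p u div k) (p v div k))"
      using * verts_sc by simp
  qed (use c' verts_sc place_range layer_range in auto)
  then show ?thesis
    using wf_reach_graph treewidth_reach_graph[OF D(2)] is_path_graph_line_graph
    unfolding M_def by blast
qed

end
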